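(* For all integers $n,k\ge 0$, $$p^{k+1}_n=\sum_{s=0}^{n}\binom{n}{s}\,p^k_s.$$
   Context: A preferential arrangement of a finite set $S$ is an ordered set partition of $S$ (a sequence of nonempty pairwise disjoint blocks with union $S$); the empty set has exactly one. Let $a(w)$ be the number of preferential arrangements of a $w$-element set ($a(0)=1$). A barred preferential arrangement of $X_n=\{1,\dots,n\}$ with $k$ bars is a sequence of $k+1$ possibly empty, pairwise disjoint sections with union $X_n$, each equipped with a preferential arrangement of its elements. A restricted section is one whose preferential arrangement has at most one block; a free section may carry any preferential arrangement. For $k\ge0$, $p^k_n$ is the number of barred preferential arrangements of $X_n$ with $k$ bars in which one fixed section is free and the other $k$ sections are restricted; equivalently $p^k_n=\sum_{w_1+\cdots+w_{k+1}=n}\frac{n!}{w_1!\cdots w_{k+1}!}a(w_{1})$ (sum over nonnegative integer solutions). *)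

theory Defs
  imports Main "HOL-Library.Disjoint_Sets"
begin

text \<open>A preferential arrangement is the list of its blocks, in order; \<open>partition_on\<close> already
  forces the blocks to be nonempty, and \<open>distinct\<close> makes list entries at different positions
  different (hence disjoint) blocks.\<close>

definition preferential_arrangements :: "'a set \<Rightarrow> 'a set list set" where
  "preferential_arrangements S = {bs. distinct bs \<and> partition_on S (set bs)}"

text \<open>With \<open>k\<close> bars there are \<open>k + 1\<close> sections, indexed by \<open>0, \<dots>, k\<close>. Only the preferential
  arrangement of each section is recorded: the section itself is the union of its blocks, so
  \<open>Sec\<close> is determined on the index set \<open>{..k}\<close> and the existential causes no miscounting.\<close>

definition barred_preferential_arrangements :: "nat \<Rightarrow> 'a set \<Rightarrow> 'a set list list set" where
  "barred_preferential_arrangements k X =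
     {bpa. length bpa = k + 1 \<and>
        (\<exists>Sec. disjoint_family_on Sec {..k} \<and> (\<Union>i\<le>k. Sec i) = X \<and>
           (\<forall>i\<le>k. bpa ! i \<in> preferential_arrangements (Sec i)))}"

definition restricted_section :: "'a set list \<Rightarrow> bool" where
  "restricted_section bs \<longleftrightarrow> length bs \<le> 1"

text \<open>\<open>p k n\<close> stands for \<open>p\<^sup>k\<^sub>n\<close>; the fixed free section is the first one (index 0), the
  sections with indices \<open>1, \<dots>, k\<close> are restricted.\<close>

definition p :: "nat \<Rightarrow> nat \<Rightarrow> nat" where
  "p k n = card {bpa \<in> barred_preferential_arrangements k {1..n}.
                   \<forall>i\<in>{1..k}. restricted_section (bpa ! i)}"

end

theory Submission
  imports Defs
begin

text \<open>The last section of an arrangement with \<open>k + 1\<close> bars is restricted, so it is determined by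
  its underlying set. Removing it therefore leaves an arrangement with \<open>k\<close> bars of a subset \<open>T\<close>
  of the ground set, from which the original can be recovered; summing over \<open>T\<close>, grouped by
  cardinality, gives the recurrence.\<close>

text \<open>The set counted by \<open>p\<close>, but over an arbitrary ground set: removing a
  section leaves an arrangement of a subset that need not be an initial segment
  \<open>{1..s}\<close>.\<close>

definition one_free_section :: "nat \<Rightarrow> 'a set \<Rightarrow> 'a set list list set" where
  "one_free_section k X = {bpa \<in> barred_preferential_arrangements k X.
                             \<forall>i\<in>{1..k}. restricted_section (bpa ! i)}"

text \<open>The empty set needs its own case because a block may not be empty.\<close>

definition block_list :: "'a set \<Rightarrow> 'a set list" where
  "block_list S = (if S = {} then [] else [S])"

lemma block_list_eq_iff [simp]: "block_list S = block_list T \<longleftrightarrow> S = T"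
  by (auto simp: block_list_def)

text \<open>Blocks are nonempty with union \<open>S\<close>: having no block forces \<open>S\<close>
  to be empty, and a single block must be \<open>S\<close> itself. So a restricted section carries
  no information beyond its underlying set.\<close>

lemma restricted_preferential_arrangement_iff:
  "bs \<in> preferential_arrangements S \<and> restricted_section bs \<longleftrightarrow> bs = block_list S"
proof (cases bs)
  case Nil
  then show ?thesis
    by (auto simp: preferential_arrangements_def restricted_section_def block_list_def
        partition_on_def)
next
  case (Cons b cs)
  then show ?thesis
    by (cases cs)
      (auto simp: preferential_arrangements_def restricted_section_def block_list_def
        partition_on_def)
qed

lemma finite_preferential_arrangements:
  assumes "finite S"
  shows "finite (preferential_arrangements S)"
proof (rule finite_subset)
  show "preferential_arrangements S \<subseteq> {bs. set bs \<subseteq> Pow S \<and> distinct bs}"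
    by (auto simp: preferential_arrangements_def partition_on_def)
  show "finite {bs. set bs \<subseteq> Pow S \<and> distinct bs}"
    using assms by (intro finite_subset_distinct) simp
qed

text \<open>Relabelling every block along \<open>f\<close> is injective and keeps the order of the
  blocks. An inequality suffices, since the inverse bijection supplies the converse.\<close>

lemma card_preferential_arrangements_le:
  assumes "finite T" "bij_betw f S T"
  shows "card (preferential_arrangements S) \<le> card (preferential_arrangements T)"
proof (rule card_inj_on_le[where f = "map (image f)"])
  have inj: "inj_on f S" and T: "T = f ` S"
    using assms by (auto simp: bij_betw_def)
  have inj_Pow: "inj_on (image f) (Pow S)"
    using inj by (rule inj_on_image_Pow)
  have sub: "set bs \<subseteq> Pow S" if "bs \<in> preferential_arrangements S" for bs
    using that by (auto simp: preferential_arrangements_def partition_on_def)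
  show "inj_on (map (image f)) (preferential_arrangements S)"
  proof (rule inj_onI)
    fix bs cs
    assume "bs \<in> preferential_arrangements S" "cs \<in> preferential_arrangements S"
      and eq: "map (image f) bs = map (image f) cs"
    \<comment> \<open>Taking images under \<open>f\<close> is known to be injective only on subsets
      of \<open>S\<close>, so the blocks of both lists have to be placed there.\<close>
    then have "set bs \<union> set cs \<subseteq> Pow S"
      using sub by blast
    then show "bs = cs"
      using map_inj_on[OF eq] inj_Pow inj_on_subset by blast
  qed
  show "map (image f) ` preferential_arrangements S \<subseteq> preferential_arrangements T"
  proof clarify
    fix bs assume bs: "bs \<in> preferential_arrangements S"
    have "inj_on (image f) (set bs)"
      using sub[OF bs] inj_Pow inj_on_subset by blast
    moreover have "partition_on (f ` S) (image f ` set bs)"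
    proof (rule partition_onI)
      show "\<Union> (image f ` set bs) = f ` S"
        using bs by (auto simp: preferential_arrangements_def partition_on_def)
      show "disjnt B C" if "B \<in> image f ` set bs" "C \<in> image f ` set bs" "B \<noteq> C" for B C
      proof -
        from that obtain B' C' where BC: "B' \<in> set bs" "C' \<in> set bs" "B = f ` B'" "C = f ` C'"
          by blast
        then have "B' \<inter> C' = {}"
          using bs \<open>B \<noteq> C\<close>
          by (auto simp: preferential_arrangements_def partition_on_def disjoint_def)
        \<comment> \<open>Inside \<open>S\<close>, injectivity makes images commute with
          intersections, so disjoint blocks have disjoint images.\<close>
        moreover have "B' \<subseteq> S" "C' \<subseteq> S"
          using BC sub[OF bs] by auto
        ultimately show ?thesis
          using inj BC inj_on_image_Int[OF inj, of B' C'] by (simp add: disjnt_def)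
      qed
      show "{} \<notin> image f ` set bs"
        using bs by (auto simp: preferential_arrangements_def partition_on_def)
    qed
    ultimately show "map (image f) bs \<in> preferential_arrangements T"
      using bs by (simp add: T preferential_arrangements_def distinct_map)
  qed
  show "finite (preferential_arrangements T)"
    using assms(1) by (rule finite_preferential_arrangements)
qed

lemma card_preferential_arrangements_cong:
  assumes "finite S" "finite T" "card S = card T"
  shows "card (preferential_arrangements S) = card (preferential_arrangements T)"
proof -
  obtain f where f: "bij_betw f S T"
    using assms finite_same_card_bij by blast
  show ?thesis
    using card_preferential_arrangements_le[OF assms(2) f]
      card_preferential_arrangements_le[OF assms(1) bij_betw_inv_into[OF f]]
    by (rule le_antisym)
qed

lemma one_free_section_0:
  "one_free_section 0 X = (\<lambda>bs. [bs]) ` preferential_arrangements X"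
proof -
  have "bpa \<in> one_free_section 0 X \<longleftrightarrow> length bpa = 1 \<and> bpa ! 0 \<in> preferential_arrangements X"
    for bpa
    by (auto simp: one_free_section_def barred_preferential_arrangements_def
        disjoint_family_on_def intro: exI[of _ "\<lambda>_. X"])
  then have "one_free_section 0 X = {bpa. length bpa = 1 \<and> bpa ! 0 \<in> preferential_arrangements X}"
    by blast
  also have "\<dots> = (\<lambda>bs. [bs]) ` preferential_arrangements X"
    by (auto simp: length_Suc_conv)
  finally show ?thesis .
qed

text \<open>\<open>T\<close> is the union of the sections before the last. As the sections are
  disjoint and cover \<open>X\<close>, the last one is \<open>X - T\<close>, and being restricted it
  can only be arranged as \<open>block_list (X - T)\<close>.\<close>

lemma one_free_section_Suc:
  "one_free_section (Suc k) X =
     (\<lambda>(T, bpa). bpa @ [block_list (X - T)]) ` (SIGMA T:Pow X. one_free_section k T)"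
proof (intro equalityI subsetI)
  fix bpa assume bpa: "bpa \<in> one_free_section (Suc k) X"
  then obtain Sec where len: "length bpa = k + 2"
    and disj: "disjoint_family_on Sec {..Suc k}" and X: "(\<Union>i\<le>Suc k. Sec i) = X"
    and pa: "\<And>i. i \<le> Suc k \<Longrightarrow> bpa ! i \<in> preferential_arrangements (Sec i)"
    and res: "\<And>i. 1 \<le> i \<Longrightarrow> i \<le> Suc k \<Longrightarrow> restricted_section (bpa ! i)"
    by (auto simp: one_free_section_def barred_preferential_arrangements_def)
  define T where "T = (\<Union>i\<le>k. Sec i)"
  obtain xs l where xs: "bpa = xs @ [l]"
    using len by (cases bpa rule: rev_cases) auto
  then have len_xs: "length xs = k + 1"
    using len by simp
  have nth: "bpa ! i = xs ! i" if "i \<le> k" for i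
    using that len_xs by (simp add: xs nth_append)
  have "disjoint_family_on Sec {..k}"
    using disj by (auto simp: disjoint_family_on_def)
  moreover have "xs ! i \<in> preferential_arrangements (Sec i)" if "i \<le> k" for i
    using that pa[of i] nth by simp
  moreover have "restricted_section (xs ! i)" if "i \<in> {1..k}" for i
    using that res[of i] nth by simp
  ultimately have "xs \<in> one_free_section k T"
    using len_xs by (auto simp: one_free_section_def barred_preferential_arrangements_def T_def)
  moreover have "Sec i \<inter> Sec (Suc k) = {}" if "i \<le> k" for i
    using disj that by (intro disjoint_family_onD) auto
  then have "T \<inter> Sec (Suc k) = {}"
    by (auto simp: T_def)
  then have "X - T = Sec (Suc k)" "T \<subseteq> X"
    using X by (auto simp: T_def atMost_Suc)
  moreover have "l = block_list (Sec (Suc k))"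
    using pa[of "Suc k"] res[of "Suc k"] len_xs
    by (simp add: xs nth_append flip: restricted_preferential_arrangement_iff)
  ultimately show "bpa \<in> (\<lambda>(T, bpa). bpa @ [block_list (X - T)]) `
      (SIGMA T:Pow X. one_free_section k T)"
    using xs by (intro image_eqI[where x = "(T, xs)"]) auto
next
  fix bpa assume "bpa \<in> (\<lambda>(T, bpa). bpa @ [block_list (X - T)]) `
      (SIGMA T:Pow X. one_free_section k T)"
  then obtain T xs where T: "T \<subseteq> X" and xs: "xs \<in> one_free_section k T"
    and bpa: "bpa = xs @ [block_list (X - T)]"
    by auto
  from xs obtain Sec where len: "length xs = k + 1"
    and disj: "disjoint_family_on Sec {..k}" and TU: "(\<Union>i\<le>k. Sec i) = T"
    and pa: "\<And>i. i \<le> k \<Longrightarrow> xs ! i \<in> preferential_arrangements (Sec i)"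
    and res: "\<And>i. 1 \<le> i \<Longrightarrow> i \<le> k \<Longrightarrow> restricted_section (xs ! i)"
    by (auto simp: one_free_section_def barred_preferential_arrangements_def)
  \<comment> \<open>The complement of \<open>T\<close> becomes the new last section; the update
    leaves the indices up to \<open>k\<close> alone and keeps the family disjoint, since the old
    sections lie in \<open>T\<close>.\<close>
  define Sec' where "Sec' = Sec(Suc k := X - T)"
  have "disjoint_family_on Sec' {..Suc k}"
    using disj TU by (fastforce simp: Sec'_def disjoint_family_on_def le_Suc_eq)
  moreover have "(\<Union>i\<le>Suc k. Sec' i) = X"
  proof -
    have "(\<Union>i\<le>k. Sec' i) = T"
      unfolding TU[symmetric] by (intro SUP_cong) (auto simp: Sec'_def)
    then show ?thesis
      using T by (auto simp: atMost_Suc Sec'_def)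
  qed
  moreover have last: "block_list (X - T) \<in> preferential_arrangements (X - T)"
    "restricted_section (block_list (X - T))"
    using restricted_preferential_arrangement_iff by blast+
  have "bpa ! i \<in> preferential_arrangements (Sec' i)" if "i \<le> Suc k" for i
    using that pa[of i] last len by (auto simp: bpa nth_append Sec'_def le_Suc_eq)
  moreover have "restricted_section (bpa ! i)" if "i \<in> {1..Suc k}" for i
    using that res[of i] last len by (auto simp: bpa nth_append le_Suc_eq)
  ultimately show "bpa \<in> one_free_section (Suc k) X"
    using len unfolding one_free_section_def barred_preferential_arrangements_def
    by (intro CollectI conjI exI[of _ Sec'] allI ballI impI) (simp_all add: bpa)
qed

lemma finite_one_free_section: "finite X \<Longrightarrow> finite (one_free_section k X)"
proof (induction k arbitrary: X)
  case 0
  then show ?case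
    by (simp add: one_free_section_0 finite_preferential_arrangements)
next
  case (Suc k)
  then have "finite (one_free_section k T)" if "T \<in> Pow X" for T
    using that finite_subset by blast
  with Suc.prems show ?case
    unfolding one_free_section_Suc by (intro finite_imageI finite_SigmaI) simp_all
qed

lemma card_one_free_section_Suc:
  assumes "finite X"
  shows "card (one_free_section (Suc k) X) = (\<Sum>T\<in>Pow X. card (one_free_section k T))"
proof -
  \<comment> \<open>The last entry determines \<open>X - T\<close>, and hence \<open>T\<close>,
    because \<open>T\<close> lies in \<open>X\<close>; the other entries are
    \<open>bpa\<close>.\<close>
  have "inj_on (\<lambda>(T, bpa). bpa @ [block_list (X - T)]) (SIGMA T:Pow X. one_free_section k T)"
    by (auto simp: inj_on_def)
  then have "card (one_free_section (Suc k) X) = card (SIGMA T:Pow X. one_free_section k T)"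
    unfolding one_free_section_Suc by (rule card_image)
  also have "\<dots> = (\<Sum>T\<in>Pow X. card (one_free_section k T))"
    using assms by (intro card_SigmaI) (auto intro: finite_one_free_section finite_subset)
  finally show ?thesis .
qed

lemma sum_Pow_card:
  fixes g :: "nat \<Rightarrow> nat"
  assumes "finite X"
  shows "(\<Sum>T\<in>Pow X. g (card T)) = (\<Sum>s=0..card X. (card X choose s) * g s)"
proof -
  have "(\<Sum>T\<in>Pow X. g (card T)) = (\<Sum>s=0..card X. \<Sum>T\<in>{T \<in> Pow X. card T = s}. g (card T))"
    using assms by (intro sum.group[symmetric]) (auto intro: card_mono)
  also have "\<dots> = (\<Sum>s=0..card X. (card X choose s) * g s)"
    using n_subsets[OF assms] by (intro sum.cong) auto
  finally show ?thesis .
qed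

lemma p_eq_card_one_free_section: "p k n = card (one_free_section k {1..n})"
  by (simp add: p_def one_free_section_def)

lemma card_one_free_section_0:
  "card (one_free_section 0 X) = card (preferential_arrangements X)"
  unfolding one_free_section_0 by (rule card_image) (simp add: inj_on_def)

text \<open>Only the case without bars needs a transport along a bijection; afterwards the
  recurrence itself shows that the count depends on the size of \<open>X\<close> alone. The ground
  sets are sets of naturals because the induction compares \<open>X\<close> with
  \<open>{1..card X}\<close>.\<close>

lemma card_one_free_section:
  fixes X :: "nat set"
  assumes "finite X"
  shows "card (one_free_section k X) = p k (card X)"
  using assms
proof (induction k arbitrary: X)
  case 0
  then show ?case
    using card_preferential_arrangements_cong[of X "{1..card X}"]
    by (simp add: p_eq_card_one_free_section card_one_free_section_0)
next
  case (Suc k)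
  \<comment> \<open>The right-hand side sees \<open>Y\<close> only through \<open>card Y\<close>, so
    its instances at \<open>X\<close> and at \<open>{1..card X}\<close> agree.\<close>
  have "card (one_free_section (Suc k) Y) = (\<Sum>s=0..card Y. (card Y choose s) * p k s)"
    if "finite Y" for Y :: "nat set"
  proof -
    have "(\<Sum>T\<in>Pow Y. card (one_free_section k T)) = (\<Sum>T\<in>Pow Y. p k (card T))"
      using that by (intro sum.cong) (auto intro: Suc.IH finite_subset)
    then show ?thesis
      using that by (simp add: card_one_free_section_Suc sum_Pow_card)
  qed
  from this[of X] this[of "{1..card X}"] show ?case
    using Suc.prems by (simp add: p_eq_card_one_free_section)
qed

theorem theorem5:
  fixes n k :: nat
  shows "p (k + 1) n = (\<Sum>s=0..n. (n choose s) * p k s)"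
proof -
  have "p (k + 1) n = (\<Sum>T\<in>Pow {1..n}. card (one_free_section k T))"
    by (simp add: p_eq_card_one_free_section card_one_free_section_Suc)
  also have "\<dots> = (\<Sum>T\<in>Pow {1..n}. p k (card T))"
    by (intro sum.cong) (auto intro: card_one_free_section finite_subset)
  also have "\<dots> = (\<Sum>s=0..n. (n choose s) * p k s)"
    by (simp add: sum_Pow_card)
  finally show ?thesis .
qed

end
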